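(* Let $k\ge2$ be a fixed integer and let $G_1,\ldots,G_k$ be mutually independent random graphs, with $G_i$ distributed as $G(n,p_i)$, where $p_i=p_i(n)$ satisfies $\omega(\log n/n)\le p_i\le o(n^{-1/2})$ for all $i\in\{1,\ldots,k\}$ (that is, $np_i/\log n\to\infty$ and $n^{1/2}p_i\to0$ as $n\to\infty$). Then $$\mathbb P[\text{at least two of the graphs } G_1,\ldots,G_k \text{ are isomorphic}]\le\binom k2\cdot o(n^{-1/2})$$ and $$\mathbb P[\text{all the graphs } G_1,\ldots,G_k \text{ are isomorphic}]\le o(n^{-(k-1)/2}).$$
   Context: Asymptotics are as $n\to\infty$. $G(n,p)$ is the Erdős–Rényi random graph on $n$ vertices, in which each pair of vertices is joined by an edge independently with probability $p$. "At least two graphs are isomorphic" means that there exist indices $i\ne j$ with $G_i$ isomorphic to $G_j$. *)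

theory Defs
  imports "HOL-Probability.Probability" "HOL-Library.Landau_Symbols"
begin

text \<open>A simple graph on the vertex set \<open>{..<n}\<close> is represented by its edge set,
  a subset of \<open>vertex_pairs n\<close>.\<close>

definition vertex_pairs :: "nat \<Rightarrow> nat set set" where
  "vertex_pairs n = {e. e \<subseteq> {..<n} \<and> card e = 2}"

definition erdos_renyi :: "nat \<Rightarrow> real \<Rightarrow> nat set set pmf" where
  "erdos_renyi n p =
     map_pmf (\<lambda>f. {e \<in> vertex_pairs n. f e})
       (Pi_pmf (vertex_pairs n) False (\<lambda>_. bernoulli_pmf p))"

text \<open>Only edges inside \<open>{..<n}\<close> are inspected, so that events built from this relation
  depend on finitely many edge indicators and are measurable, even though the type
  \<^typ>\<open>nat set set\<close> is uncountable.\<close>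

definition graph_isomorphic :: "nat \<Rightarrow> nat set set \<Rightarrow> nat set set \<Rightarrow> bool" where
  "graph_isomorphic n E F \<longleftrightarrow>
     (\<exists>\<pi>. bij_betw \<pi> {..<n} {..<n} \<and>
          (\<forall>u<n. \<forall>v<n. {u, v} \<in> E \<longleftrightarrow> {\<pi> u, \<pi> v} \<in> F))"

end

theory Submission
  imports Defs
begin

text \<open>Isomorphic graphs have equally many edges, and the edge count of a random graph is already
  spread out enough to make such a coincidence rare. The number of edges of \<open>G(n, p)\<close> is binomial
  with \<open>n choose 2\<close> trials, so its standard deviation is of order \<open>n * sqrt p\<close> and no single value
  has probability more than a constant divided by \<open>n * sqrt p\<close> (\<open>pmf_binomial_le\<close>). Since
  \<open>n * p\<close> tends to infinity, this is \<open>o(n powr (-1/2))\<close> (\<open>max_pmf_binomial_smallo\<close>).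

  Let \<open>\<epsilon>\<close> bound the probability of every value of every edge count. Independence then
  bounds the probability that the graphs with indices in \<open>J\<close> all have the same number of edges by
  \<open>\<epsilon> ^ (card J - 1)\<close>: whatever the first count is, each of the others hits it with probability
  at most \<open>\<epsilon>\<close> (\<open>prob_indep_all_equal_le\<close>). With \<open>J\<close> the whole index set this bounds the
  probability that all graphs are isomorphic; with \<open>J\<close> ranging over the two-element sets it gives,
  by a union bound, the estimate for at least one isomorphic pair.\<close>

section \<open>The largest point probability of a binomial distribution\<close>

text \<open>The ratio of consecutive probabilities, cross-multiplied so that it holds for every \<open>m\<close>:
  from \<open>m = N\<close> on, both sides vanish.\<close>

lemma pmf_binomial_ratio:
  assumes "0 \<le> p" "p \<le> 1"
  shows "pmf (binomial_pmf N p) (Suc m) * (real m + 1) * (1 - p)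
         = pmf (binomial_pmf N p) m * (real N - real m) * p"
proof (cases "m < N")
  case True
  have "Suc m * (N choose Suc m) = (N - m) * (N choose m)"
    using binomial_absorb_comp[of N m] binomial_absorption[of m "N"] True
    by (metis Suc_times_binomial_eq Suc_pred' binomial_absorption diff_Suc_1 not_less_zero
        bot_nat_0.not_eq_extremum)
  then have eq: "(real m + 1) * real (N choose Suc m) = (real N - real m) * real (N choose m)"
    using True by (metis of_nat_Suc of_nat_diff of_nat_mult less_imp_le add.commute)
  have "N - m = Suc (N - Suc m)" using True by simp
  then have q: "(1 - p) ^ (N - m) = (1 - p) * (1 - p) ^ (N - Suc m)" by simp
  have "pmf (binomial_pmf N p) (Suc m) * (real m + 1) * (1 - p)
        = ((real m + 1) * real (N choose Suc m)) * (p ^ Suc m * ((1 - p) * (1 - p) ^ (N - Suc m)))"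
    using assms by (simp add: pmf_binomial mult_ac)
  also have "\<dots> = ((real N - real m) * real (N choose m)) * (p ^ Suc m * (1 - p) ^ (N - m))"
    by (simp only: eq q)
  also have "\<dots> = pmf (binomial_pmf N p) m * (real N - real m) * p"
    using assms by (simp add: pmf_binomial mult_ac)
  finally show ?thesis .
next
  case False
  then have "N choose Suc m = 0" "m = N \<or> N choose m = 0"
    by (auto simp: binomial_eq_0)
  then show ?thesis using assms by (auto simp: binomial_eq_0)
qed

text \<open>Around its mode \<open>M\<close> the distribution is flat on the scale of the square root of
  \<open>\<mu> = (N + 1) p\<close>. The mode lies in \<open>[\<mu> - 1, \<mu>]\<close>, so by the ratio formula the step from
  \<open>M + j\<close> to \<open>M + j + 1\<close> loses at most a fraction \<open>2 (j + 1) / \<mu>\<close> of the maximum. Hence the first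
  \<open>sqrt (\<mu> / 2)\<close> values after the mode are all at least half the maximum; as they sum to at most
  \<open>1\<close>, the maximum is small.\<close>

lemma pmf_binomial_le:
  assumes p: "0 < p" "p \<le> 1/2"
  shows "pmf (binomial_pmf N p) m \<le> 4 / sqrt ((real N + 1) * p / 2)"
proof -
  define b where "b = pmf (binomial_pmf N p)"
  define \<mu> where "\<mu> = (real N + 1) * p"
  have \<mu>: "\<mu> > 0" using p by (simp add: \<mu>_def)
  have b_nonneg: "0 \<le> b j" for j by (simp add: b_def)
  have rec: "b (Suc j) * (real j + 1) * (1 - p) = b j * (real N - real j) * p" for j
    using pmf_binomial_ratio[of p N j] p by (simp add: b_def)
  have "Max (b ` {..N}) \<in> b ` {..N}" by (intro Max_in) auto
  then obtain M where "Max (b ` {..N}) = b M" by blast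
  then have M: "b j \<le> b M" if "j \<le> N" for j
    using Max_ge[of "b ` {..N}" "b j"] that by auto
  have b_le: "b j \<le> b M" for j
  proof (cases "j \<le> N")
    case False
    then have "b j = 0" using p by (simp add: b_def pmf_binomial binomial_eq_0)
    then show ?thesis by (simp add: b_nonneg)
  qed (rule M)
  have "0 < b 0" using p by (simp add: b_def pmf_binomial)
  then have pos: "0 < b M" using b_le[of 0] by linarith
  have M_ge: "\<mu> \<le> real M + 1"
  proof -
    have "b M * ((real N - real M) * p) = b (Suc M) * ((real M + 1) * (1 - p))"
      using rec[of M] by (simp add: mult_ac)
    also have "\<dots> \<le> b M * ((real M + 1) * (1 - p))"
      using b_le p by (intro mult_right_mono) auto
    finally have "(real N - real M) * p \<le> (real M + 1) * (1 - p)" using pos by simp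
    then show ?thesis by (simp add: \<mu>_def algebra_simps)
  qed
  have M_le: "real M \<le> \<mu>"
  proof (cases M)
    case 0 then show ?thesis using \<mu> by simp
  next
    case (Suc L)
    have "b M * ((real L + 1) * (1 - p)) = b L * ((real N - real L) * p)"
      using rec[of L] Suc by (simp add: mult_ac)
    also have "\<dots> \<le> b M * ((real N - real L) * p)"
    proof (cases "L \<le> N")
      case True
      then show ?thesis using b_le p by (intro mult_right_mono) auto
    next
      case False
      then have "b M = 0" using p Suc by (simp add: b_def pmf_binomial binomial_eq_0)
      then show ?thesis using pos by simp
    qed
    finally have "(real L + 1) * (1 - p) \<le> (real N - real L) * p" using pos by simp
    then show ?thesis using Suc by (simp add: \<mu>_def algebra_simps)
  qed
  \<comment> \<open>The relative loss in one step is \<open>(y - \<mu>) / (y (1 - p))\<close>, where \<open>1 - p \<ge> 1/2\<close>.\<close>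
  have decr: "b (M + j) - b (Suc (M + j)) \<le> b M * (2 * (real j + 1) / \<mu>)" for j
  proof -
    define y where "y = real (M + j) + 1"
    have y: "\<mu> \<le> y" "y - \<mu> \<le> real j + 1" "0 < y"
      using M_ge M_le \<mu> by (auto simp: y_def)
    have "(b (M + j) - b (Suc (M + j))) * (y * (1 - p)) = b (M + j) * (y - \<mu>)"
      using rec[of "M + j"] by (simp add: y_def \<mu>_def algebra_simps)
    then have "b (M + j) - b (Suc (M + j)) = b (M + j) * ((y - \<mu>) / (y * (1 - p)))"
      using y p by (simp add: field_simps)
    also have "\<dots> \<le> b M * ((real j + 1) / (\<mu> * (1/2)))"
      using y p \<mu> b_le b_nonneg
      by (intro mult_mono frac_le divide_nonneg_nonneg mult_nonneg_nonneg mult_pos_pos) auto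
    finally show ?thesis by (simp add: mult_ac)
  qed
  have near: "b M * (1 - real j * (real j + 1) / \<mu>) \<le> b (M + j)" for j
  proof (induction j)
    case (Suc j)
    have "b M * (1 - real (Suc j) * (real (Suc j) + 1) / \<mu>)
       = b M * (1 - real j * (real j + 1) / \<mu>) - b M * (2 * (real j + 1) / \<mu>)"
      using \<mu> by (simp add: field_simps)
    then show ?case using Suc decr[of j] unfolding add_Suc_right by linarith
  qed simp
  show ?thesis
  proof (cases "\<mu> / 2 < 1")
    case True
    \<comment> \<open>The claimed bound exceeds \<open>1\<close>; treating this case apart lets the window below be nonempty.\<close>
    have "pmf (binomial_pmf N p) m \<le> 1" by (rule pmf_le_1)
    also have "1 \<le> 4 / sqrt (\<mu> / 2)"
      using True \<mu> real_sqrt_le_1_iff[of "\<mu>/2"] by (simp add: le_divide_eq del: real_sqrt_le_1_iff)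
    finally show ?thesis by (simp add: \<mu>_def)
  next
    case False
    define s where "s = sqrt (\<mu> / 2)"
    define J where "J = nat \<lfloor>s\<rfloor>"
    have s: "1 \<le> s" "s^2 = \<mu> / 2" using False \<mu> by (auto simp: s_def)
    have J: "real J \<le> s" "s < real J + 1" using s by (auto simp: J_def)
    have "1 \<le> J" using s le_nat_floor[of 1 s] by (simp add: J_def)
    then have J2: "s / 2 \<le> real J" using J by linarith
    have half: "b M / 2 \<le> b (M + j)" if "j < J" for j
    proof -
      have "real j + 1 \<le> s" using that J by linarith
      then have "real j * (real j + 1) \<le> s * s" by (intro mult_mono) auto
      then have "real j * (real j + 1) / \<mu> \<le> 1 / 2" using s \<mu> by (simp add: power2_eq_square field_simps)
      then have "b M * (1/2) \<le> b M * (1 - real j * (real j + 1) / \<mu>)"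
        using pos by (intro mult_left_mono) auto
      then show ?thesis using near[of j] by linarith
    qed
    have "real J * (b M / 2) \<le> (\<Sum>j<J. b (M + j))"
      using sum_mono[of "{..<J}" "\<lambda>_. b M / 2" "\<lambda>j. b (M + j)"] half by simp
    also have "\<dots> = sum b ((+) M ` {..<J})" by (simp add: sum.reindex)
    also have "\<dots> = measure_pmf.prob (binomial_pmf N p) ((+) M ` {..<J})"
      by (simp add: b_def measure_measure_pmf_finite)
    also have "\<dots> \<le> 1" by simp
    finally have "real J * b M \<le> 2" by simp
    then have "(s / 2) * b M \<le> 2" using mult_right_mono[OF J2, of "b M"] pos by linarith
    then have "b M \<le> 4 / s" using s by (simp add: field_simps)
    then show ?thesis using b_le[of m] by (simp add: b_def s_def \<mu>_def)
  qed
qed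

text \<open>There are about \<open>n\<^sup>2 / 2\<close> pairs, so \<open>pmf_binomial_le\<close> gives a bound of order
  \<open>1 / sqrt (n\<^sup>2 p) = n powr (-1/2) / sqrt (n p)\<close>, and the second factor tends to \<open>0\<close>.\<close>

lemma max_pmf_binomial_smallo:
  fixes p :: "nat \<Rightarrow> real"
  assumes np: "filterlim (\<lambda>n. real n * p n) at_top sequentially"
    and half: "\<forall>\<^sub>F n in sequentially. p n \<le> 1/2"
  shows "(\<lambda>n. \<Squnion>m. pmf (binomial_pmf (n choose 2) (p n)) m) \<in> o(\<lambda>n. real n powr (-1/2))"
proof -
  have lim0: "(\<lambda>n. 4 * sqrt 8 / sqrt (real n * p n)) \<longlonglongrightarrow> 0"
    by (intro tendsto_divide_0[OF tendsto_const] filterlim_at_top_imp_at_infinity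
        filterlim_compose[OF sqrt_at_top np])
  have ev: "\<forall>\<^sub>F n in sequentially.
     norm (\<Squnion>m. pmf (binomial_pmf (n choose 2) (p n)) m)
       \<le> norm (4 * sqrt 8 / sqrt (real n * p n) * real n powr (-1/2))"
    using half filterlim_at_top_dense[THEN iffD1, OF np, rule_format, of 0] eventually_ge_at_top[of 1]
  proof eventually_elim
    case (elim n)
    have n: "1 \<le> real n" using elim by simp
    have p_half: "p n \<le> 1/2" by (rule elim)
    have p_pos: "0 < p n" using elim n by (simp add: zero_less_mult_iff)
    have "real n * real n \<le> 4 * (real (n choose 2) + 1)"
    proof -
      have "even (n * (n - 1))" by (cases n) auto
      then have "2 * (n choose 2) = n * (n - 1)"
        unfolding choose_two by (rule dvd_mult_div_cancel)
      then have "2 * real (n choose 2) = real n * (real n - 1)"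
        using elim by (metis of_nat_mult of_nat_numeral of_nat_diff of_nat_1)
      moreover have "0 \<le> (real n - 1)^2" by simp
      ultimately show ?thesis by (simp add: power2_eq_square algebra_simps)
    qed
    then have le: "real n * real n * p n / 8 \<le> (real (n choose 2) + 1) * p n / 2"
      using mult_right_mono[of "real n * real n" _ "p n / 8"] p_pos by fastforce
    have nn: "0 < real n * real n * p n / 8" using n p_pos by simp
    have "(\<Squnion>m. pmf (binomial_pmf (n choose 2) (p n)) m) \<le> 4 / sqrt ((real (n choose 2) + 1) * p n / 2)"
      by (rule cSUP_least) (auto intro: pmf_binomial_le p_pos p_half)
    also have "\<dots> \<le> 4 / sqrt (real n * real n * p n / 8)"
      using le nn by (intro divide_left_mono) auto
    also have "\<dots> = 4 * sqrt 8 / sqrt (real n * p n) * real n powr (-1/2)"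
      using n p_pos
      by (simp add: real_sqrt_divide real_sqrt_mult powr_minus powr_half_sqrt field_simps)
    finally have "(\<Squnion>m. pmf (binomial_pmf (n choose 2) (p n)) m) \<le>
        4 * sqrt 8 / sqrt (real n * p n) * real n powr (-1/2)" .
    moreover have "0 \<le> (\<Squnion>m. pmf (binomial_pmf (n choose 2) (p n)) m)"
      by (rule cSUP_upper2[of _ _ 0]) (auto intro!: bdd_aboveI[of _ 1] pmf_le_1)
    ultimately show ?case using n p_pos by simp
  qed
  show ?thesis
  proof (rule landau_o.big_small_trans[OF landau_o.big_mono[OF ev]])
    have "(\<lambda>n. 4 * sqrt 8 / sqrt (real n * p n)) \<in> o(\<lambda>_. 1)"
      using lim0 by (intro smalloI_tendsto) auto
    then show "(\<lambda>n. 4 * sqrt 8 / sqrt (real n * p n) * real n powr (-1/2))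
        \<in> o(\<lambda>n. real n powr (-1/2))"
      using landau_o.small_big_mult[OF _ landau_o.big_refl, of _ _ "\<lambda>_. 1"] by fastforce
  qed
qed

section \<open>The number of edges\<close>

text \<open>Intersecting with \<open>vertex_pairs n\<close> keeps the count bounded for arbitrary values
  of type \<^typ>\<open>nat set set\<close>, including the loops and stray edges that a random graph may have
  on a null set.\<close>

definition edge_count :: "nat \<Rightarrow> nat set set \<Rightarrow> nat" where
  "edge_count n E = card (E \<inter> vertex_pairs n)"

lemma finite_vertex_pairs: "finite (vertex_pairs n)"
  by (simp add: vertex_pairs_def)

lemma card_vertex_pairs: "card (vertex_pairs n) = n choose 2"
  using n_subsets[of "{..<n}" 2] by (simp add: vertex_pairs_def)

lemma edge_count_le: "edge_count n E \<le> n choose 2"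
  unfolding edge_count_def card_vertex_pairs[symmetric]
  by (intro card_mono finite_vertex_pairs) auto

lemma edge_count_erdos_renyi:
  assumes "0 \<le> p" "p \<le> 1"
  shows "map_pmf (edge_count n) (erdos_renyi n p) = binomial_pmf (n choose 2) p"
proof -
  have *: "{e \<in> vertex_pairs n. f e} \<inter> vertex_pairs n = {e \<in> vertex_pairs n. f e}" for f
    by auto
  show ?thesis
    using assms finite_vertex_pairs[of n] card_vertex_pairs[of n]
    by (subst binomial_pmf_altdef'[of "vertex_pairs n" _ _ False])
       (auto simp: erdos_renyi_def map_pmf_comp edge_count_def *)
qed

text \<open>A vertex permutation that maps edges of \<open>E\<close> to edges of \<open>F\<close> acts injectively on edges. The
  one-sided form can be applied both to an isomorphism and to its inverse.\<close>

lemma edge_count_le_of_embedding: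
  assumes "bij_betw \<pi> {..<n} {..<n}"
    and "\<And>u v. u < n \<Longrightarrow> v < n \<Longrightarrow> {u, v} \<in> E \<Longrightarrow> {\<pi> u, \<pi> v} \<in> F"
  shows "edge_count n E \<le> edge_count n F"
  unfolding edge_count_def
proof (rule card_inj_on_le[of "image \<pi>"])
  have inj: "inj_on \<pi> {..<n}" using assms(1) by (rule bij_betw_imp_inj_on)
  then show "inj_on (image \<pi>) (E \<inter> vertex_pairs n)"
    by (intro inj_on_subset[OF inj_on_image_Pow]) (auto simp: vertex_pairs_def)
  show "image \<pi> ` (E \<inter> vertex_pairs n) \<subseteq> F \<inter> vertex_pairs n"
  proof safe
    fix e assume e: "e \<in> E" "e \<in> vertex_pairs n"
    then have sub: "e \<subseteq> {..<n}" and "card e = 2" by (auto simp: vertex_pairs_def)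
    then obtain u v where uv: "e = {u, v}" by (auto simp: card_2_iff)
    then show "\<pi> ` e \<in> F" using assms(2) sub e by auto
    show "\<pi> ` e \<in> vertex_pairs n"
      using sub \<open>card e = 2\<close> assms(1) card_image[OF inj_on_subset[OF inj sub]]
      by (auto simp: vertex_pairs_def bij_betw_def)
  qed
  show "finite (F \<inter> vertex_pairs n)" by (simp add: finite_vertex_pairs)
qed

lemma graph_isomorphic_imp_edge_count_eq:
  assumes "graph_isomorphic n E F"
  shows "edge_count n E = edge_count n F"
proof (rule antisym)
  obtain \<pi> where bij: "bij_betw \<pi> {..<n} {..<n}"
    and iso: "\<And>u v. u < n \<Longrightarrow> v < n \<Longrightarrow> {u, v} \<in> E \<longleftrightarrow> {\<pi> u, \<pi> v} \<in> F"
    using assms unfolding graph_isomorphic_def by blast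
  show "edge_count n E \<le> edge_count n F"
    using bij iso by (intro edge_count_le_of_embedding[of \<pi>]) auto
  let ?\<rho> = "the_inv_into {..<n} \<pi>"
  have inv: "bij_betw ?\<rho> {..<n} {..<n}" by (rule bij_betw_the_inv_into[OF bij])
  have \<rho>: "?\<rho> u < n" "\<pi> (?\<rho> u) = u" if "u < n" for u
    using that inv bij by (auto simp: bij_betw_def f_the_inv_into_f)
  show "edge_count n F \<le> edge_count n E"
    using inv iso[OF \<rho>(1) \<rho>(1)] \<rho> by (intro edge_count_le_of_embedding[of ?\<rho>]) auto
qed

section \<open>Coincidences of independent random variables\<close>

text \<open>Single out one index \<open>i0\<close> and sum over the common value \<open>x\<close>: the factors for the other indices
  are at most \<open>c\<close> each, and the factors for \<open>i0\<close> sum to at most \<open>1\<close>. The set \<open>A\<close> stands for an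
  event that implies the coincidence, such as an isomorphism between random graphs; it may be
  non-measurable, since its \<open>prob\<close> is then \<open>0\<close>.\<close>

lemma (in prob_space) prob_indep_all_equal_le:
  fixes X :: "'i \<Rightarrow> 'a \<Rightarrow> 'b"
  assumes indep: "indep_vars (\<lambda>_. count_space UNIV) X I"
    and J: "J \<subseteq> I" "finite J" "J \<noteq> {}"
    and S: "finite S" "\<And>i \<omega>. i \<in> J \<Longrightarrow> X i \<omega> \<in> S"
    and c: "\<And>i x. i \<in> J \<Longrightarrow> \<P>(\<omega> in M. X i \<omega> = x) \<le> c"
    and A: "A \<subseteq> {\<omega> \<in> space M. \<forall>i\<in>J. \<forall>j\<in>J. X i \<omega> = X j \<omega>}"
  shows "prob A \<le> c ^ (card J - 1)"
proof -
  obtain i0 where i0: "i0 \<in> J" using J by auto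
  have meas: "X i \<in> measurable M (count_space UNIV)" if "i \<in> J" for i
    using indep that J unfolding indep_vars_def by auto
  have ev: "{\<omega> \<in> space M. X i \<omega> = x} \<in> events" if "i \<in> J" for i x
    using measurable_sets[OF meas[OF that], of "{x}"] by (simp add: vimage_def Int_def conj_commute)
  have ev_all: "{\<omega> \<in> space M. \<forall>i\<in>J. X i \<omega> = x} \<in> events" for x
    using ev J by (intro sets.sets_Collect_finite_All) auto
  have prod: "\<P>(\<omega> in M. \<forall>i\<in>J. X i \<omega> = x) = (\<Prod>i\<in>J. \<P>(\<omega> in M. X i \<omega> = x))" for x
  proof -
    have "{\<omega> \<in> space M. \<forall>i\<in>J. X i \<omega> = x} = (\<Inter>i\<in>J. X i -` {x} \<inter> space M)"
      using J by auto
    moreover have "{\<omega> \<in> space M. X i \<omega> = x} = X i -` {x} \<inter> space M" for i by auto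
    ultimately show ?thesis using indep_varsD[OF indep J(3,2,1), of "\<lambda>_. {x}"] by simp
  qed
  have cover: "A \<subseteq> (\<Union>x\<in>S. {\<omega> \<in> space M. \<forall>i\<in>J. X i \<omega> = x})"
  proof
    fix \<omega> assume "\<omega> \<in> A"
    then have "\<omega> \<in> space M" "\<forall>i\<in>J. X i \<omega> = X i0 \<omega>" using A i0 by auto
    then show "\<omega> \<in> (\<Union>x\<in>S. {\<omega> \<in> space M. \<forall>i\<in>J. X i \<omega> = x})" using S(2)[OF i0] by blast
  qed
  have "prob A \<le> prob (\<Union>x\<in>S. {\<omega> \<in> space M. \<forall>i\<in>J. X i \<omega> = x})"
    using S ev_all cover by (intro finite_measure_mono sets.finite_UN) auto
  also have "\<dots> \<le> (\<Sum>x\<in>S. \<P>(\<omega> in M. \<forall>i\<in>J. X i \<omega> = x))"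
    using S ev_all by (intro finite_measure_subadditive_finite) auto
  also have "\<dots> \<le> (\<Sum>x\<in>S. \<P>(\<omega> in M. X i0 \<omega> = x) * c ^ (card J - 1))"
  proof (intro sum_mono)
    fix x
    have "(\<Prod>i\<in>J. \<P>(\<omega> in M. X i \<omega> = x))
        = \<P>(\<omega> in M. X i0 \<omega> = x) * (\<Prod>i\<in>J - {i0}. \<P>(\<omega> in M. X i \<omega> = x))"
      using J i0 by (intro prod.remove)
    also have "\<dots> \<le> \<P>(\<omega> in M. X i0 \<omega> = x) * (\<Prod>i\<in>J - {i0}. c)"
      using c by (intro mult_left_mono prod_mono) auto
    also have "\<dots> = \<P>(\<omega> in M. X i0 \<omega> = x) * c ^ (card J - 1)"
      using J i0 by simp
    finally show "\<P>(\<omega> in M. \<forall>i\<in>J. X i \<omega> = x)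
        \<le> \<P>(\<omega> in M. X i0 \<omega> = x) * c ^ (card J - 1)"
      by (simp add: prod)
  qed
  also have "\<dots> = prob (\<Union>x\<in>S. {\<omega> \<in> space M. X i0 \<omega> = x}) * c ^ (card J - 1)"
    using S ev i0
    by (subst finite_measure_finite_Union) (auto simp: disjoint_family_on_def sum_distrib_right)
  also have "\<dots> \<le> 1 * c ^ (card J - 1)"
    using c[OF i0] order_trans[OF measure_nonneg c[OF i0]] by (intro mult_right_mono) auto
  finally show ?thesis by simp
qed

section \<open>Isomorphisms among independent random graphs\<close>

theorem theorem4p1:
  fixes k :: nat
    and M :: "nat \<Rightarrow> 'a measure"
    and G :: "nat \<Rightarrow> nat \<Rightarrow> 'a \<Rightarrow> nat set set"
    and p :: "nat \<Rightarrow> nat \<Rightarrow> real"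
  assumes "k \<ge> 2"
    and "\<And>n. prob_space (M n)"
    and "\<And>n. prob_space.indep_vars (M n) (\<lambda>_. count_space UNIV) (\<lambda>i. G i n) {1..k}"
    and "\<And>i n. i \<in> {1..k} \<Longrightarrow> 0 \<le> p i n \<and> p i n \<le> 1"
    and "\<And>i n. i \<in> {1..k} \<Longrightarrow>
           distr (M n) (count_space UNIV) (G i n) = measure_pmf (erdos_renyi n (p i n))"
    and "\<And>i. i \<in> {1..k} \<Longrightarrow>
           filterlim (\<lambda>n. real n * p i n / ln (real n)) at_top sequentially"
    and "\<And>i. i \<in> {1..k} \<Longrightarrow> (\<lambda>n. real n powr (1/2) * p i n) \<longlonglongrightarrow> 0"
  shows "(\<exists>\<epsilon>. \<epsilon> \<in> o(\<lambda>n. real n powr (-1/2)) \<and>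
            (\<forall>n. \<P>(\<omega> in M n. \<exists>i\<in>{1..k}. \<exists>j\<in>{1..k}.
                     i \<noteq> j \<and> graph_isomorphic n (G i n \<omega>) (G j n \<omega>))
                 \<le> real (k choose 2) * \<epsilon> n)) \<and>
         (\<exists>\<epsilon>. \<epsilon> \<in> o(\<lambda>n. real n powr (-(real k - 1)/2)) \<and>
            (\<forall>n. \<P>(\<omega> in M n. \<forall>i\<in>{1..k}. \<forall>j\<in>{1..k}.
                     graph_isomorphic n (G i n \<omega>) (G j n \<omega>)) \<le> \<epsilon> n))"
proof -
  define N where "N n = n choose 2" for n :: nat
  define b where "b i n = (\<Squnion>m. pmf (binomial_pmf (N n) (p i n)) m)" for i n
  define \<epsilon> where "\<epsilon> n = (\<Sum>i\<in>{1..k}. b i n)" for n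
  define X where "X n i \<omega> = edge_count n (G i n \<omega>)" for n i \<omega>
  have small: "\<epsilon> \<in> o(\<lambda>n. real n powr (-1/2))"
    unfolding \<epsilon>_def b_def N_def
  proof (intro big_sum_in_smallo max_pmf_binomial_smallo)
    fix i assume i: "i \<in> {1..k}"
    show "filterlim (\<lambda>n. real n * p i n) at_top sequentially"
    proof (rule filterlim_at_top_mono[OF assms(6)[OF i]])
      show "\<forall>\<^sub>F n in sequentially. real n * p i n / ln (real n) \<le> real n * p i n"
        using eventually_ge_at_top[of 3]
      proof eventually_elim
        case (elim n)
        have "exp 1 \<le> real n" using exp_le elim by linarith
        then have "1 \<le> ln (real n)" using ln_ge_iff[of "real n" 1] elim by simp
        then show ?case
          using assms(4)[OF i, of n] mult_left_mono[of 1 "ln (real n)" "real n * p i n"]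
          by (simp add: divide_le_eq)
      qed
    qed
    have "\<forall>\<^sub>F n in sequentially. real n powr (1/2) * p i n < 1/2"
      using order_tendstoD(2)[OF assms(7)[OF i], of "1/2"] by simp
    then show "\<forall>\<^sub>F n in sequentially. p i n \<le> 1/2"
      using eventually_ge_at_top[of 1]
    proof eventually_elim
      case (elim n)
      then have "1 \<le> real n powr (1/2)" by (simp add: ge_one_powr_ge_zero)
      then have "p i n \<le> real n powr (1/2) * p i n"
        using assms(4)[OF i, of n] mult_right_mono[of 1] by fastforce
      then show ?case using elim by linarith
    qed
  qed
  have pmf_le_b: "pmf (binomial_pmf (N n) (p i n)) m \<le> b i n" for i n m
    unfolding b_def by (rule cSUP_upper) (auto intro!: bdd_aboveI[of _ 1] pmf_le_1)
  have b_nonneg: "0 \<le> b i n" for i n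
    using pmf_nonneg pmf_le_b by (rule order_trans)
  have X_indep: "prob_space.indep_vars (M n) (\<lambda>_. count_space UNIV) (X n) {1..k}" for n
    unfolding X_def using assms(3)[of n]
    by (rule prob_space.indep_vars_compose2[OF assms(2)]) auto
  have prob_X: "\<P>(\<omega> in M n. X n i \<omega> = m) \<le> \<epsilon> n" if i: "i \<in> {1..k}" for n i m
  proof -
    interpret prob_space "M n" by (rule assms(2))
    have meas: "G i n \<in> measurable (M n) (count_space UNIV)"
      using assms(3)[of n] i unfolding indep_vars_def by auto
    have "\<P>(\<omega> in M n. X n i \<omega> = m)
      = measure (distr (M n) (count_space UNIV) (G i n)) (edge_count n -` {m})"
      by (subst measure_distr[OF meas]) (auto simp: X_def intro!: arg_cong[where f = "measure (M n)"])
    also have "\<dots> = pmf (map_pmf (edge_count n) (erdos_renyi n (p i n))) m"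
      by (simp add: assms(5)[OF i] pmf_map)
    also have "\<dots> = pmf (binomial_pmf (N n) (p i n)) m"
      using assms(4)[OF i] by (simp add: edge_count_erdos_renyi N_def)
    also have "\<dots> \<le> b i n" by (rule pmf_le_b)
    also have "\<dots> \<le> \<epsilon> n" unfolding \<epsilon>_def using i b_nonneg by (intro member_le_sum) auto
    finally show ?thesis .
  qed
  have iso_le: "measure (M n) A \<le> \<epsilon> n ^ (card J - 1)"
    if J: "J \<subseteq> {1..k}" "J \<noteq> {}"
      and A: "A \<subseteq> {\<omega> \<in> space (M n). \<forall>i\<in>J. \<forall>j\<in>J. X n i \<omega> = X n j \<omega>}"
    for n J A
  proof -
    interpret prob_space "M n" by (rule assms(2))
    show ?thesis
      using X_indep[of n] J A prob_X finite_subset[OF J(1)] edge_count_le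
      by (intro prob_indep_all_equal_le[where X = "X n" and S = "{..N n}"])
         (auto simp: X_def N_def)
  qed
  have edges: "X n i \<omega> = X n j \<omega>" if "graph_isomorphic n (G i n \<omega>) (G j n \<omega>)" for n i j \<omega>
    unfolding X_def using that by (rule graph_isomorphic_imp_edge_count_eq)
  have two: "\<P>(\<omega> in M n. \<exists>i\<in>{1..k}. \<exists>j\<in>{1..k}.
      i \<noteq> j \<and> graph_isomorphic n (G i n \<omega>) (G j n \<omega>)) \<le> real (k choose 2) * \<epsilon> n" for n
  proof -
    interpret prob_space "M n" by (rule assms(2))
    define \<E> where "\<E> = {e. e \<subseteq> {1..k} \<and> card e = 2}"
    define B where "B e = {\<omega> \<in> space (M n). \<forall>i\<in>e. \<forall>j\<in>e. X n i \<omega> = X n j \<omega>}" for e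
    have fin: "finite \<E>" and card: "card \<E> = k choose 2"
      using n_subsets[of "{1..k}" 2] by (auto simp: \<E>_def)
    have X_meas: "X n i \<in> measurable (M n) (count_space UNIV)" if "i \<in> {1..k}" for i
      using X_indep[of n] that unfolding indep_vars_def by blast
    have eq_ev: "{\<omega> \<in> space (M n). X n i \<omega> = X n j \<omega>} \<in> events"
      if "i \<in> {1..k}" "j \<in> {1..k}" for i j
    proof -
      have "{\<omega> \<in> space (M n). X n i \<omega> = X n j \<omega>} =
          (\<Union>m. (X n i -` {m} \<inter> space (M n)) \<inter> (X n j -` {m} \<inter> space (M n)))"
        by auto
      also have "\<dots> \<in> events"
        using X_meas that by (intro sets.countable_UN sets.Int image_subsetI measurable_sets) auto
      finally show ?thesis .
    qed
    \<comment> \<open>Subadditivity needs the coincidence events themselves to be measurable.\<close>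
    have B_ev: "B e \<in> events" if "e \<in> \<E>" for e
    proof -
      have "finite e" "e \<subseteq> {1..k}" using that by (auto simp: \<E>_def intro: card_ge_0_finite)
      then show ?thesis unfolding B_def
        by (intro sets.sets_Collect_finite_All) (auto intro!: eq_ev)
    qed
    have "{\<omega> \<in> space (M n). \<exists>i\<in>{1..k}. \<exists>j\<in>{1..k}.
        i \<noteq> j \<and> graph_isomorphic n (G i n \<omega>) (G j n \<omega>)} \<subseteq> (\<Union>e\<in>\<E>. B e)"
    proof clarify
      fix \<omega> i j
      assume "\<omega> \<in> space (M n)" "i \<in> {1..k}" "j \<in> {1..k}" "i \<noteq> j"
        "graph_isomorphic n (G i n \<omega>) (G j n \<omega>)"
      then have "{i, j} \<in> \<E>" "\<omega> \<in> B {i, j}" using edges by (auto simp: \<E>_def B_def)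
      then show "\<omega> \<in> (\<Union>e\<in>\<E>. B e)" by blast
    qed
    then have "\<P>(\<omega> in M n. \<exists>i\<in>{1..k}. \<exists>j\<in>{1..k}.
        i \<noteq> j \<and> graph_isomorphic n (G i n \<omega>) (G j n \<omega>)) \<le> prob (\<Union>e\<in>\<E>. B e)"
      using fin B_ev by (intro finite_measure_mono) auto
    also have "\<dots> \<le> (\<Sum>e\<in>\<E>. prob (B e))"
      using fin B_ev by (intro finite_measure_subadditive_finite) auto
    also have "\<dots> \<le> (\<Sum>e\<in>\<E>. \<epsilon> n)"
    proof (rule sum_mono)
      fix e assume "e \<in> \<E>"
      then have e: "e \<subseteq> {1..k}" "card e = 2" by (auto simp: \<E>_def)
      then have "e \<noteq> {}" by auto
      then show "prob (B e) \<le> \<epsilon> n" using iso_le[of e "B e" n] e by (simp add: B_def)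
    qed
    finally show ?thesis by (simp add: card)
  qed
  have all: "\<P>(\<omega> in M n. \<forall>i\<in>{1..k}. \<forall>j\<in>{1..k}.
      graph_isomorphic n (G i n \<omega>) (G j n \<omega>)) \<le> \<epsilon> n ^ (k - 1)" for n
  proof -
    have "{\<omega> \<in> space (M n). \<forall>i\<in>{1..k}. \<forall>j\<in>{1..k}. graph_isomorphic n (G i n \<omega>) (G j n \<omega>)}
        \<subseteq> {\<omega> \<in> space (M n). \<forall>i\<in>{1..k}. \<forall>j\<in>{1..k}. X n i \<omega> = X n j \<omega>}"
      using edges by blast
    from iso_le[OF order_refl _ this] assms(1) show ?thesis by simp
  qed
  have "(\<lambda>n. \<epsilon> n ^ (k - 1)) \<in> o(\<lambda>n. (real n powr (-1/2)) ^ (k - 1))"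
    using small assms(1) by (intro landau_o.small_power) auto
  also have "(\<lambda>n. (real n powr (-1/2)) ^ (k - 1)) = (\<lambda>n. real n powr (-(real k - 1)/2))"
  proof
    fix n
    have "real (k - 1) = real k - 1" using assms(1) by (simp add: of_nat_diff)
    then have e: "(-1/2) * real (k - 1) = -(real k - 1)/2"
      by (simp only: times_divide_eq_left mult_minus_left mult_1)
    show "(real n powr (-1/2)) ^ (k - 1) = real n powr (-(real k - 1)/2)"
    proof (cases "n = 0")
      case False
      then have "(real n powr (-1/2)) ^ (k - 1) = real n powr ((-1/2) * real (k - 1))"
        by (simp add: powr_powr flip: powr_realpow)
      then show ?thesis by (simp only: e)
    qed (use assms(1) in simp)
  qed
  finally show ?thesis using small two all by blast
qed

end
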